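(* Let $X$ be an essentially connected geodesic mm-space and let $\nu\in\mathcal V$. Then the following (1), (2), and (3) are equivalent to each other. (1) $\nu$ is an iso-dominant of $X$. (2) $X$ satisfies $\mathrm{ICL}(\nu)$. (3) $X$ satisfies $\mathrm{IC}(\nu)$.
   Context: An mm-space is a complete separable metric space $(X,d_X)$ with a Borel probability measure $\mu_X$; it is assumed that $X=\operatorname{supp}\mu_X$. It is geodesic if any two points are joined by a minimal geodesic. $\mathcal V$ is the set of Borel probability measures on $\mathbb R$ absolutely continuous with respect to the Lebesgue measure $\mathcal L^1$ and with connected support. $V(t)=\nu((-\infty,t])$ is the cumulative distribution function of $\nu$. For a Borel set $A\subset X$, $\mu_X^+(A):=\limsup_{\varepsilon\to0+}\frac{\mu_X(U_\varepsilon(A))-\mu_X(A)}{\varepsilon}$, where $U_\varepsilon(A)$ is the open $\varepsilon$-neighborhood of $A$. $X$ is essentially connected if $\mu_X^+(A)>0$ for any closed set $A\subset X$ with $0<\mu_X(A)<1$. Let $\operatorname{Im}\mu_X$ be the set of values $\mu_X(A)$, $A\subset X$ Borel, and $I_X(v):=\inf\{\mu_X^+(A)\mid A\subset X\text{ Borel},\ \mu_X(A)=v\}$ for $v\in\operatorname{Im}\mu_X$. $\mathrm{IC}(\nu)$: $I_X\circ V\ge V'$ holds $\mathcal L^1$-a.e. on $V^{-1}(\operatorname{Im}\mu_X)$. $\mathrm{ICL}(\nu)$: for any $a,b\in\operatorname{supp}\nu$ with $a\le b$ and any Borel set $A\subset X$ with $\mu_X(A)>0$, if $V(a)\le\mu_X(A)$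 then $V(b)\le\mu_X(B_{b-a}(A))$, where $B_r(A)=\{x\in X\mid d_X(x,A)\le r\}$ is the closed $r$-neighborhood. $\nu$ is an iso-dominant of $X$ if for any $1$-Lipschitz function $f:X\to\mathbb R$ there exists a monotone nondecreasing $1$-Lipschitz function $h:\mathbb R\to\mathbb R$ with $f_*\mu_X=h_*\nu$. *)

theory Defs
  imports "HOL-Probability.Probability"
begin

(* The metric space X is a type of class polish_space (complete and second countable),
   so an mm-space is given by its measure alone. *)

definition msupp :: "'a::topological_space measure \<Rightarrow> 'a set" where
  "msupp M = {x. \<forall>U. open U \<and> x \<in> U \<longrightarrow> emeasure M U > 0}"

definition mm_space :: "'a::polish_space measure \<Rightarrow> bool" where
  "mm_space M \<longleftrightarrow> prob_space M \<and> sets M = sets borel \<and> msupp M = UNIV"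

definition geodesic_space :: "'a::metric_space itself \<Rightarrow> bool" where
  "geodesic_space _ \<longleftrightarrow>
     (\<forall>x y :: 'a. \<exists>\<gamma> :: real \<Rightarrow> 'a. \<gamma> 0 = x \<and> \<gamma> (dist x y) = y \<and>
        (\<forall>s\<in>{0..dist x y}. \<forall>t\<in>{0..dist x y}. dist (\<gamma> s) (\<gamma> t) = \<bar>s - t\<bar>))"

definition open_nbhd :: "real \<Rightarrow> 'a::metric_space set \<Rightarrow> 'a set" where
  "open_nbhd \<epsilon> A = {x. \<exists>a\<in>A. dist x a < \<epsilon>}"

(* infdist x {} = 0 in the library, whereas here d(x, {}) is infinite: hence the guard. *)
definition closed_nbhd :: "real \<Rightarrow> 'a::metric_space set \<Rightarrow> 'a set" where
  "closed_nbhd r A = {x. A \<noteq> {} \<and> infdist x A \<le> r}"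

definition boundary_measure :: "'a::metric_space measure \<Rightarrow> 'a set \<Rightarrow> ereal" where
  "boundary_measure M A =
     Limsup (at_right 0) (\<lambda>\<epsilon>::real. ereal ((measure M (open_nbhd \<epsilon> A) - measure M A) / \<epsilon>))"

definition essentially_connected :: "'a::metric_space measure \<Rightarrow> bool" where
  "essentially_connected M \<longleftrightarrow>
     (\<forall>A. closed A \<and> 0 < measure M A \<and> measure M A < 1 \<longrightarrow> boundary_measure M A > 0)"

definition Im_measure :: "'a::metric_space measure \<Rightarrow> real set" where
  "Im_measure M = measure M ` sets borel"

definition isoperimetric_profile :: "'a::metric_space measure \<Rightarrow> real \<Rightarrow> ereal" where
  "isoperimetric_profile M v =
     (INF A\<in>{A \<in> sets borel. measure M A = v}. boundary_measure M A)"

definition class_V :: "real measure set" where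
  "class_V = {\<nu>. prob_space \<nu> \<and> sets \<nu> = sets borel \<and>
                 absolutely_continuous lborel \<nu> \<and> connected (msupp \<nu>)}"

(* For \<nu> in class_V the monotone function cdf \<nu> is differentiable almost everywhere, so the
   value of deriv at points of non-differentiability is irrelevant. *)
definition IC :: "'a::metric_space measure \<Rightarrow> real measure \<Rightarrow> bool" where
  "IC M \<nu> \<longleftrightarrow>
     (AE t in lborel. cdf \<nu> t \<in> Im_measure M \<longrightarrow>
        isoperimetric_profile M (cdf \<nu> t) \<ge> ereal (deriv (cdf \<nu>) t))"

definition ICL :: "'a::metric_space measure \<Rightarrow> real measure \<Rightarrow> bool" where
  "ICL M \<nu> \<longleftrightarrow>
     (\<forall>a\<in>msupp \<nu>. \<forall>b\<in>msupp \<nu>. \<forall>A\<in>sets borel.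
        a \<le> b \<and> measure M A > 0 \<and> cdf \<nu> a \<le> measure M A \<longrightarrow>
        cdf \<nu> b \<le> measure M (closed_nbhd (b - a) A))"

definition iso_dominant :: "real measure \<Rightarrow> 'a::metric_space measure \<Rightarrow> bool" where
  "iso_dominant \<nu> M \<longleftrightarrow>
     (\<forall>f :: 'a \<Rightarrow> real. 1-lipschitz_on UNIV f \<longrightarrow>
        (\<exists>h :: real \<Rightarrow> real. mono h \<and> 1-lipschitz_on UNIV h \<and>
           distr M borel f = distr \<nu> borel h))"

end

theory Submission
  imports Defs
begin

text \<open>
  Write \<open>V = cdf \<nu>\<close>. It is continuous, and it is strictly increasing wherever it lies strictly
  between \<open>0\<close> and \<open>1\<close>, because the support of \<open>\<nu>\<close> is connected.

  An iso-dominant gives \<open>ICL\<close> by testing it on the distance function from a set \<open>A\<close>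
  (\<open>iso_dominant_imp_ICL\<close>): its sublevel sets are the closed neighbourhoods of \<open>A\<close>, and the sublevel
  sets of a monotone 1-Lipschitz \<open>h\<close> with \<open>h a \<le> 0\<close> reach at least up to \<open>b\<close> at level \<open>b - a\<close>.
  Conversely, given a 1-Lipschitz \<open>f\<close> whose distribution has quantile function \<open>q\<close>, the monotone
  rearrangement \<open>h = q \<circ> V\<close> always pushes \<open>\<nu>\<close> to the distribution of \<open>f\<close>; applied to the
  sublevel sets of \<open>f\<close>, \<open>ICL\<close> says exactly that \<open>h\<close> is 1-Lipschitz (\<open>ICL_imp_iso_dominant\<close>).

  \<open>IC\<close> is the infinitesimal form of \<open>ICL\<close>, so one direction is differentiation at a point where
  \<open>V\<close> is differentiable (\<open>ICL_imp_IC\<close>). The other direction (\<open>IC_imp_ICL\<close>) integrates. Let \<open>g r\<close> be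
  the measure of the closed \<open>r\<close>-neighbourhood of \<open>A\<close>. If \<open>ICL\<close> fails for \<open>a\<close>, \<open>b\<close> and \<open>A\<close>, then
  \<open>g\<close> stays strictly between \<open>0\<close> and \<open>1\<close> on \<open>[0, b - a]\<close>, so that
  \<open>T = V\<^sup>-\<^sup>1 \<circ> g\<close> is defined there, and \<open>T\<close> grows by less than \<open>b - a\<close>. On the other hand \<open>IC\<close> says
  that the upper right derivative of \<open>g\<close> at \<open>r\<close> is at least \<open>V'(T r)\<close>, hence that of \<open>T\<close> is at
  least \<open>1\<close>, except where \<open>T r\<close> falls into the Lebesgue null set \<open>N\<close> on which \<open>IC\<close> gives no
  information. Two things have to be controlled. The exceptional set \<open>T\<^sup>-\<^sup>1(N)\<close> must be null: this is
  where essential connectedness enters, since it makes the upper derivative of \<open>g\<close> positive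
  everywhere, whereas \<open>g\<close> can only gain \<open>\<nu>(N) = 0\<close> over \<open>T\<^sup>-\<^sup>1(N)\<close>. And an upper derivative at
  least \<open>1\<close> almost everywhere must force a monotone function to grow by the full length of the
  interval, although \<open>T\<close> may have jumps and a singular part.

  Both are instances of one consequence of Vitali's covering theorem
  (\<open>vitali_cover_monotone_image\<close>): if every point of \<open>E\<close> lies in arbitrarily short intervals
  \<open>[u, v]\<close> whose image intervals \<open>(T u, T v]\<close> have \<open>\<rho>\<close>-measure at least \<open>c (v - u)\<close>, then \<open>c\<close> times
  the size of \<open>E\<close> is bounded by the \<open>\<rho>\<close>-measure of a set that contains these images. With \<open>T\<close> the
  identity the same lemma also yields that \<open>V\<close> is differentiable almost everywhere
  (\<open>AE_cdf_differentiable\<close>).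
\<close>

section \<open>Vitali coverings and monotone functions\<close>

text \<open>
  Vitali's theorem picks countably many disjoint intervals \<open>[u, v]\<close> that cover almost all of \<open>E\<close>.
  As \<open>T\<close> is monotone, the half-open image intervals \<open>(T u, T v]\<close> are disjoint as well, so their
  \<open>\<rho>\<close>-measures add up to at most \<open>\<rho> Q\<close>. Since only image
  intervals are measured, \<open>E\<close> and its image may be any sets.
\<close>

lemma vitali_cover_monotone_image:
  fixes T :: "real \<Rightarrow> real" and \<rho> :: "real measure"
  assumes sets: "sets \<rho> = sets borel" and Q: "Q \<in> sets borel"
    and mono: "mono_on D T" and c: "0 < c"
    and cov: "\<And>t d. t \<in> E \<Longrightarrow> 0 < d \<Longrightarrow> \<exists>u\<in>D. \<exists>v\<in>D. u < v \<and> u \<le> t \<and> t \<le> v \<and> v - u < d \<and>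
        {T u<..T v} \<subseteq> Q \<and> ennreal (c * (v - u)) \<le> emeasure \<rho> {T u<..T v}"
  obtains B where "B \<in> sets borel" "negligible (E - B)"
    "ennreal c * emeasure lborel B \<le> emeasure \<rho> Q"
proof -
  define K where "K = {(u, v). u \<in> D \<and> v \<in> D \<and> u < v \<and> {T u<..T v} \<subseteq> Q \<and>
    ennreal (c * (v - u)) \<le> emeasure \<rho> {T u<..T v}}"
  have cball_eq: "cball ((fst i + snd i) / 2) ((snd i - fst i) / 2) = {fst i..snd i}" for i :: "real \<times> real"
    by (auto simp: cball_def dist_real_def abs_le_iff field_simps)
  obtain C where C: "countable C" "C \<subseteq> K"
      "pairwise (\<lambda>i j. disjnt (cball ((fst i + snd i) / 2) ((snd i - fst i) / 2))
                              (cball ((fst j + snd j) / 2) ((snd j - fst j) / 2))) C"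
      "negligible (E - (\<Union>i\<in>C. cball ((fst i + snd i) / 2) ((snd i - fst i) / 2)))"
  proof (rule Vitali_covering_theorem_cballs
      [of K "\<lambda>i. (snd i - fst i) / 2" E "\<lambda>i. (fst i + snd i) / 2"])
    fix i assume "i \<in> K"
    then show "0 < (snd i - fst i) / 2" by (auto simp: K_def)
  next
    fix t d :: real assume "t \<in> E" "0 < d"
    from cov[OF this] obtain u v where "(u, v) \<in> K" "u \<le> t" "t \<le> v" "v - u < d"
      unfolding K_def by blast
    moreover have "v - u \<ge> 0" using \<open>u \<le> t\<close> \<open>t \<le> v\<close> by simp
    ultimately show "\<exists>i. i \<in> K \<and> t \<in> cball ((fst i + snd i) / 2) ((snd i - fst i) / 2) \<and>
        (snd i - fst i) / 2 < d"
      unfolding cball_eq by (intro exI[of _ "(u, v)"]) auto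
  qed
  define B where "B = (\<Union>i\<in>C. {fst i..snd i})"
  have disj: "disjnt {fst i..snd i} {fst j..snd j}" if "i \<in> C" "j \<in> C" "i \<noteq> j" for i j
    using C(3) that unfolding cball_eq pairwise_def by blast
  \<comment> \<open>Disjoint intervals are ordered, which is what turns monotonicity into disjoint images.\<close>
  have order: "snd i < fst j \<or> snd j < fst i" if "i \<in> C" "j \<in> C" "i \<noteq> j" for i j
  proof (rule ccontr)
    assume "\<not> ?thesis"
    moreover have "fst i < snd i" "fst j < snd j" using C(2) that by (auto simp: K_def)
    ultimately have "max (fst i) (fst j) \<in> {fst i..snd i} \<inter> {fst j..snd j}" by auto
    then show False using disj[OF that] by (auto simp: disjnt_def)
  qed
  have "ennreal c * emeasure lborel B
      = ennreal c * (\<integral>\<^sup>+i. emeasure lborel {fst i..snd i} \<partial>count_space C)"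
    unfolding B_def using disj C(1)
    by (subst emeasure_UN_countable) (auto simp: disjoint_family_on_def disjnt_def)
  also have "\<dots> = (\<integral>\<^sup>+i. ennreal c * emeasure lborel {fst i..snd i} \<partial>count_space C)"
    by (simp add: nn_integral_cmult)
  also have "\<dots> \<le> (\<integral>\<^sup>+i. emeasure \<rho> {T (fst i)<..T (snd i)} \<partial>count_space C)"
  proof (rule nn_integral_mono)
    fix i assume "i \<in> space (count_space C)"
    then have "i \<in> K" using C(2) by auto
    then show "ennreal c * emeasure lborel {fst i..snd i} \<le> emeasure \<rho> {T (fst i)<..T (snd i)}"
      using c by (auto simp: K_def ennreal_mult'[symmetric])
  qed
  also have "\<dots> = emeasure \<rho> (\<Union>i\<in>C. {T (fst i)<..T (snd i)})"
  proof (rule emeasure_UN_countable[symmetric])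
    have "T (snd i) \<le> T (fst j)" if "i \<in> C" "j \<in> C" "snd i < fst j" for i j
      using mono C(2) that by (auto simp: K_def intro!: mono_onD[OF mono])
    then have "{T (fst i)<..T (snd i)} \<inter> {T (fst j)<..T (snd j)} = {}"
      if "i \<in> C" "j \<in> C" "i \<noteq> j" for i j
      using order[OF that] that by fastforce
    then show "disjoint_family_on (\<lambda>i. {T (fst i)<..T (snd i)}) C"
      by (auto simp: disjoint_family_on_def)
  qed (use C sets in auto)
  also have "\<dots> \<le> emeasure \<rho> Q"
  proof (rule emeasure_mono)
    have "{T (fst i)<..T (snd i)} \<subseteq> Q" if "i \<in> C" for i
    proof -
      have "i \<in> K" using C(2) that by blast
      then show ?thesis by (auto simp: K_def)
    qed
    then show "(\<Union>i\<in>C. {T (fst i)<..T (snd i)}) \<subseteq> Q" by blast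
  qed (use Q sets in simp)
  finally have "ennreal c * emeasure lborel B \<le> emeasure \<rho> Q" .
  moreover have "B \<in> sets borel" unfolding B_def using C(1) by auto
  moreover have "negligible (E - B)" using C(4) unfolding cball_eq B_def .
  ultimately show ?thesis using that by blast
qed

text \<open>
  A set that \<open>T\<close> maps into a \<open>\<rho>\<close>-null set \<open>N\<close>, while expanding arbitrarily short intervals at each
  of its points by a fixed factor, is Lebesgue null: choose \<open>Q\<close> in the covering lemma as an open
  neighbourhood of \<open>N\<close> of small \<open>\<rho>\<close>-measure. That the images of short intervals lie in \<open>Q\<close> is a
  form of continuity of \<open>T\<close> that one-sided continuity can supply, by intervals on that side.
\<close>

lemma negligible_expanding_preimage:
  fixes T :: "real \<Rightarrow> real" and \<rho> :: "real measure"
  assumes fin: "finite_measure \<rho>" and sets: "sets \<rho> = sets borel"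
    and N: "N \<in> sets borel" "emeasure \<rho> N = 0" and TN: "T ` E \<subseteq> N"
    and mono: "mono_on D T" and c: "0 < c"
    and cov: "\<And>t d Q. t \<in> E \<Longrightarrow> 0 < d \<Longrightarrow> open Q \<Longrightarrow> T t \<in> Q \<Longrightarrow>
        \<exists>u\<in>D. \<exists>v\<in>D. u < v \<and> u \<le> t \<and> t \<le> v \<and> v - u < d \<and>
        {T u<..T v} \<subseteq> Q \<and> c * (v - u) \<le> measure \<rho> {T u<..T v}"
  shows "negligible E"
  unfolding negligible_outer_le
proof (intro allI impI)
  interpret finite_measure \<rho> by fact
  fix e :: real assume e: "0 < e"
  have "(INF U\<in>{U. N \<subseteq> U \<and> open U}. emeasure \<rho> U) < ennreal (c * e)"
    using outer_regular[OF sets _ N(1)] N(2) c e emeasure_finite[of "space \<rho>"] by simp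
  then obtain Q where Q: "N \<subseteq> Q" "open Q" "emeasure \<rho> Q < ennreal (c * e)"
    unfolding INF_less_iff by blast
  obtain B where B: "B \<in> sets borel" "negligible (E - B)"
    "ennreal c * emeasure lborel B \<le> emeasure \<rho> Q"
  proof (rule vitali_cover_monotone_image[OF sets _ mono c])
    fix t d :: real assume "t \<in> E" "0 < d"
    from cov[OF this \<open>open Q\<close>] show "\<exists>u\<in>D. \<exists>v\<in>D. u < v \<and> u \<le> t \<and> t \<le> v \<and> v - u < d \<and>
        {T u<..T v} \<subseteq> Q \<and> ennreal (c * (v - u)) \<le> emeasure \<rho> {T u<..T v}"
      using TN Q(1) \<open>t \<in> E\<close> by (auto simp: emeasure_eq_measure ennreal_leI)
  qed (use Q in auto)
  have "ennreal c * emeasure lborel B \<le> ennreal c * ennreal e"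
    using B(3) Q(3) c e by (simp add: ennreal_mult)
  then have B_le: "emeasure lborel B \<le> ennreal e"
    using c by (simp add: ennreal_mult_le_mult_iff)
  define W where "W = B \<union> (E - B)"
  have W: "W \<in> sets lebesgue"
    unfolding W_def using B by (intro sets.Un) (auto intro: negligible_imp_sets)
  have "emeasure lebesgue W \<le> emeasure lebesgue B + emeasure lebesgue (E - B)"
    unfolding W_def using B by (intro emeasure_subadditive) (auto intro: negligible_imp_sets)
  then have W_le: "emeasure lebesgue W \<le> ennreal e"
    using B_le B by (simp add: negligible_iff_null_sets null_sets_def)
  then have "emeasure lebesgue W < \<infinity>"
    by (rule le_less_trans) simp
  with W have "W \<in> lmeasurable" by (rule fmeasurableI)
  moreover have "measure lebesgue W \<le> e"
    unfolding measure_def using W_le e by (intro enn2real_leI) simp_all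
  moreover have "E \<subseteq> W" by (auto simp: W_def)
  ultimately show "\<exists>W. E \<subseteq> W \<and> W \<in> lmeasurable \<and> measure lebesgue W \<le> e" by blast
qed

text \<open>
  The derivative of \<open>\<rho>\<close> with respect to Lebesgue measure vanishes almost everywhere on a \<open>\<rho>\<close>-null
  set: the previous lemma for the identity map.
\<close>

lemma negligible_positive_upper_density:
  fixes \<rho> :: "real measure"
  assumes "finite_measure \<rho>" "sets \<rho> = sets borel" "E \<in> sets borel" "emeasure \<rho> E = 0" "0 < \<eta>"
  shows "negligible {t \<in> E. \<forall>d>0. \<exists>u v. u < v \<and> u \<le> t \<and> t \<le> v \<and> v - u < d \<and>
           \<eta> * (v - u) < measure \<rho> {u<..v}}"
proof (rule negligible_expanding_preimage[OF assms(1-4), where T = "\<lambda>t. t" and D = UNIV and c = \<eta>])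
  fix t d :: real and Q :: "real set"
  assume t: "t \<in> {t \<in> E. \<forall>d>0. \<exists>u v. u < v \<and> u \<le> t \<and> t \<le> v \<and> v - u < d \<and>
           \<eta> * (v - u) < measure \<rho> {u<..v}}" and "0 < d" "open Q" "t \<in> Q"
  then obtain e where e: "0 < e" "ball t e \<subseteq> Q" by (meson openE)
  from t \<open>0 < d\<close> e obtain u v where uv: "u < v" "u \<le> t" "t \<le> v" "v - u < min d e"
      "\<eta> * (v - u) < measure \<rho> {u<..v}" by (auto dest: spec[of _ "min d e"])
  have "{u<..v} \<subseteq> ball t e" using uv by (auto simp: dist_real_def)
  with uv e show "\<exists>u\<in>UNIV. \<exists>v\<in>UNIV. u < v \<and> u \<le> t \<and> t \<le> v \<and> v - u < d \<and>
        {u<..v} \<subseteq> Q \<and> \<eta> * (v - u) \<le> measure \<rho> {u<..v}"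
    by (intro bexI[of _ u] bexI[of _ v]) auto
qed (use assms in \<open>auto simp: mono_on_def\<close>)

section \<open>Differentiability of distribution functions\<close>

text \<open>
  Lebesgue's differentiation theorem on the line. Let \<open>f\<close> be the density of \<open>\<nu>\<close>. For a rational \<open>q\<close>
  and \<open>\<eta> > 0\<close>, the measure with density \<open>(\<bar>f - q\<bar> - \<eta>)\<^sup>+\<close>, cut off to a bounded interval to be
  finite, vanishes on \<open>{x. \<bar>f x - q\<bar> \<le> \<eta>}\<close>, so at almost every point of this set it contributes at
  most \<open>\<eta> (v - u)\<close> to short intervals. There the mean of \<open>f\<close> over a short interval is within \<open>2 \<eta>\<close>
  of \<open>q\<close>, hence within \<open>3 \<eta>\<close> of \<open>f t\<close>.
\<close>

lemma AE_cdf_differentiable: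
  fixes \<nu> :: "real measure"
  assumes "finite_measure \<nu>" and sets: "sets \<nu> = sets borel" and ac: "absolutely_continuous lborel \<nu>"
  shows "AE t in lborel. \<exists>p. (cdf \<nu> has_real_derivative p) (at t)"
proof -
  interpret finite_borel_measure \<nu>
    using assms by (simp add: finite_borel_measure_def finite_borel_measure_axioms_def)
  have "sets \<nu> = sets lborel" using sets by simp
  from sigma_finite_measure.real_RN_deriv[OF sigma_finite_lborel assms(1) ac this]
  obtain f where f: "f \<in> borel_measurable lborel" "AE x in lborel. RN_deriv lborel \<nu> x = ennreal (f x)"
      "\<And>x. 0 \<le> f x" by metis
  have [measurable]: "f \<in> borel_measurable borel" using f(1) by simp
  have \<nu>_eq: "\<nu> = density lborel (\<lambda>x. ennreal (f x))"
  proof -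
    have "\<nu> = density lborel (RN_deriv lborel \<nu>)"
      using sigma_finite_measure.density_RN_deriv[OF sigma_finite_lborel ac] sets by simp
    also have "\<dots> = density lborel (\<lambda>x. ennreal (f x))"
      using f by (intro density_cong) auto
    finally show ?thesis .
  qed
  have nn_f: "(\<integral>\<^sup>+x. ennreal (f x) \<partial>lborel) < \<infinity>"
    using emeasure_finite[of UNIV] by (simp add: \<nu>_eq emeasure_density top.not_eq_extremum)
  have int_f: "integrable lborel f"
    using nn_f f(3) by (intro integrableI_nonneg) auto
  define g where "g q \<eta> n x = max 0 (\<bar>f x - q\<bar> - \<eta>) * indicator {- real n..real n} x" for q \<eta> n x
  have [measurable]: "g q \<eta> n \<in> borel_measurable borel" for q \<eta> n
    unfolding g_def[abs_def] by measurable
  have g_nonneg: "0 \<le> g q \<eta> n x" for q \<eta> n x by (simp add: g_def)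
  define L where "L q \<eta> n = density lborel (\<lambda>x. ennreal (g q \<eta> n x))" for q \<eta> n
  define E where "E q \<eta> = {x. \<bar>f x - q\<bar> \<le> \<eta>}" for q \<eta>
  define Bad where "Bad q \<eta> n = {t \<in> E q \<eta>. \<forall>d>0. \<exists>u v. u < v \<and> u \<le> t \<and> t \<le> v \<and> v - u < d \<and>
           \<eta> * (v - u) < measure (L q \<eta> n) {u<..v}}" for q \<eta> n
  have int_g: "integrable lborel (g q \<eta> n)" if "0 < \<eta>" for q \<eta> n
  proof (rule Bochner_Integration.integrable_bound)
    show "integrable lborel (\<lambda>x. f x + \<bar>q\<bar> * indicator {- real n..real n} x)"
      using int_f by (intro Bochner_Integration.integrable_add integrable_mult_right) auto
    show "AE x in lborel. norm (g q \<eta> n x) \<le> norm (f x + \<bar>q\<bar> * indicator {- real n..real n} x)"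
    proof (rule AE_I2)
      fix x
      have "max 0 (\<bar>f x - q\<bar> - \<eta>) \<le> f x + \<bar>q\<bar>"
        using f(3)[of x] that by linarith
      then show "norm (g q \<eta> n x) \<le> norm (f x + \<bar>q\<bar> * indicator {- real n..real n} x)"
        using f(3)[of x] by (simp add: g_def indicator_def)
    qed
  qed simp
  have meas_L: "measure (L q \<eta> n) A = (\<integral>x. g q \<eta> n x * indicator A x \<partial>lborel)"
    if "0 < \<eta>" "A \<in> sets borel" for q \<eta> n A
  proof -
    have "emeasure (L q \<eta> n) A = (\<integral>\<^sup>+x. ennreal (g q \<eta> n x * indicator A x) \<partial>lborel)"
      using that by (simp add: L_def emeasure_density ennreal_mult g_nonneg ennreal_indicator)
    then show ?thesis
      unfolding measure_def using that g_nonneg by (subst integral_eq_nn_integral) auto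
  qed
  have neg_Bad: "negligible (Bad q \<eta> n)" if "0 < \<eta>" for q \<eta> n
    unfolding Bad_def
  proof (rule negligible_positive_upper_density)
    have "(\<integral>\<^sup>+x. ennreal (g q \<eta> n x) \<partial>lborel) < \<infinity>"
      using int_g[OF that] g_nonneg by (simp add: integrable_iff_bounded)
    then show "finite_measure (L q \<eta> n)"
      by (intro finite_measureI) (simp add: L_def emeasure_density)
    show "sets (L q \<eta> n) = sets borel" by (simp add: L_def)
    show E: "E q \<eta> \<in> sets borel" unfolding E_def by measurable
    have "g q \<eta> n x * indicator (E q \<eta>) x = 0" for x
      by (auto simp: g_def E_def indicator_def max_def)
    then have z: "ennreal (g q \<eta> n x) * indicator (E q \<eta>) x = 0" for x
      by (metis ennreal_0 ennreal_indicator ennreal_mult'' indicator_pos_le)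
    have "(\<integral>\<^sup>+x. ennreal (g q \<eta> n x) * indicator (E q \<eta>) x \<partial>lborel) = (\<integral>\<^sup>+(x::real). 0 \<partial>lborel)"
      by (rule nn_integral_cong) (rule z)
    then show "emeasure (L q \<eta> n) (E q \<eta>) = 0"
      using E by (simp add: L_def emeasure_density)
  qed fact
  have "negligible (\<Union>q\<in>\<rat>. \<Union>k. \<Union>n. Bad q (1 / Suc k) n)"
    using neg_Bad unfolding negligible_iff_null_sets
    by (intro null_sets_UN' countable_rat) auto
  then have "AE t in lebesgue. t \<notin> (\<Union>q\<in>\<rat>. \<Union>k. \<Union>n. Bad q (1 / Suc k) n)"
    unfolding negligible_iff_null_sets by (rule AE_not_in)
  then have "AE t in lborel. t \<notin> (\<Union>q\<in>\<rat>. \<Union>k. \<Union>n. Bad q (1 / Suc k) n)"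
    by (simp only: AE_completion_iff)
  then show ?thesis
  proof (rule AE_mp, intro AE_I2 impI)
    fix t :: real assume t: "t \<notin> (\<Union>q\<in>\<rat>. \<Union>k. \<Union>n. Bad q (1 / Suc k) n)"
    \<comment> \<open>Any short interval containing \<open>t\<close> is admitted, so both one-sided difference quotients are covered.\<close>
    have small: "\<exists>d>0. \<forall>u v. u < v \<and> u \<le> t \<and> t \<le> v \<and> v - u < d \<longrightarrow>
        \<bar>cdf \<nu> v - cdf \<nu> u - f t * (v - u)\<bar> \<le> e * (v - u)" if "0 < e" for e
    proof -
      have "0 < e / 3" using that by simp
      from reals_Archimedean[OF this] obtain k where "inverse (real (Suc k)) < e / 3" by blast
      then have k: "3 / Suc k < e" by (simp add: field_simps del: of_nat_Suc)
      define \<eta> where "\<eta> = 1 / real (Suc k)"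
      have \<eta>: "0 < \<eta>" "3 * \<eta> < e" using k by (auto simp: \<eta>_def)
      obtain q where q: "q \<in> \<rat>" "f t < q" "q < f t + \<eta>" using Rats_dense_in_real[of "f t" "f t + \<eta>"] \<eta> by auto
      obtain n where n: "\<bar>t\<bar> < real n" using reals_Archimedean2 by blast
      have "t \<notin> Bad q \<eta> n" using t q unfolding \<eta>_def by blast
      moreover have "t \<in> E q \<eta>" using q by (simp add: E_def)
      ultimately have "\<exists>d>0. \<forall>u v. u < v \<and> u \<le> t \<and> t \<le> v \<and> v - u < d \<longrightarrow>
           measure (L q \<eta> n) {u<..v} \<le> \<eta> * (v - u)"
        unfolding Bad_def mem_Collect_eq by (meson not_less)
      then obtain d where d: "0 < d" "\<And>u v. u < v \<Longrightarrow> u \<le> t \<Longrightarrow> t \<le> v \<Longrightarrow> v - u < d \<Longrightarrow>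
           measure (L q \<eta> n) {u<..v} \<le> \<eta> * (v - u)"
        by blast
      show ?thesis
      proof (intro exI conjI allI impI)
        show "0 < min d (real n - \<bar>t\<bar>)" using d n by simp
        fix u v assume uv: "u < v \<and> u \<le> t \<and> t \<le> v \<and> v - u < min d (real n - \<bar>t\<bar>)"
        let ?I = "{u<..v}"
        have sub: "?I \<subseteq> {- real n..real n}" using uv by auto
        have i1: "integrable lborel (\<lambda>x. f x * indicator ?I x)"
          using integrable_mult_indicator[OF _ int_f, of ?I] by (simp add: mult.commute)
        have i0: "integrable lborel (indicator ?I :: real \<Rightarrow> real)"
          using uv by (intro integrable_real_indicator) auto
        have i2: "integrable lborel (\<lambda>x. q * indicator ?I x)"
          by (rule integrable_mult_right[OF i0])
        have i3: "integrable lborel (\<lambda>x. g q \<eta> n x * indicator ?I x)"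
          using integrable_mult_indicator[OF _ int_g[OF \<eta>(1)], of ?I] by (simp add: mult.commute)
        have i4: "integrable lborel (\<lambda>x. \<eta> * indicator ?I x)"
          by (rule integrable_mult_right[OF i0])
        have "cdf \<nu> v - cdf \<nu> u = measure \<nu> ?I" using uv by (simp add: cdf_diff_eq)
        also have "\<dots> = (\<integral>x. f x * indicator ?I x \<partial>lborel)"
        proof -
          have "emeasure \<nu> ?I = (\<integral>\<^sup>+x. ennreal (f x * indicator ?I x) \<partial>lborel)"
            unfolding \<nu>_eq
            using f(3) by (simp add: emeasure_density ennreal_mult ennreal_indicator)
          then show ?thesis
            unfolding measure_def using f(3) by (subst integral_eq_nn_integral) auto
        qed
        finally have "cdf \<nu> v - cdf \<nu> u - q * (v - u)
            = (\<integral>x. f x * indicator ?I x \<partial>lborel) - (\<integral>x. q * indicator ?I x \<partial>lborel)"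
          using uv by simp
        also have "\<dots> = (\<integral>x. f x * indicator ?I x - q * indicator ?I x \<partial>lborel)"
          using i1 i2 by simp
        finally have "\<bar>cdf \<nu> v - cdf \<nu> u - q * (v - u)\<bar>
            \<le> (\<integral>x. \<bar>f x * indicator ?I x - q * indicator ?I x\<bar> \<partial>lborel)"
          using integral_abs_bound by simp
        also have "\<dots> \<le> (\<integral>x. g q \<eta> n x * indicator ?I x + \<eta> * indicator ?I x \<partial>lborel)"
          using sub i1 i2 i3 i4
          by (intro integral_mono) (auto simp: g_def indicator_def)
        also have "\<dots> = measure (L q \<eta> n) ?I + \<eta> * (v - u)"
          using i3 i4 meas_L[OF \<eta>(1), of ?I] uv by simp
        also have "\<dots> \<le> 2 * \<eta> * (v - u)" using d(2)[of u v] uv by simp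
        finally have "\<bar>cdf \<nu> v - cdf \<nu> u - q * (v - u)\<bar> \<le> 2 * \<eta> * (v - u)" .
        moreover have "\<bar>(q - f t) * (v - u)\<bar> \<le> \<eta> * (v - u)"
          unfolding abs_mult using q uv by (intro mult_mono) auto
        ultimately have "\<bar>cdf \<nu> v - cdf \<nu> u - f t * (v - u)\<bar> \<le> 3 * \<eta> * (v - u)"
          by (simp add: algebra_simps abs_le_iff)
        also have "\<dots> \<le> e * (v - u)" using \<eta> uv by (intro mult_right_mono) auto
        finally show "\<bar>cdf \<nu> v - cdf \<nu> u - f t * (v - u)\<bar> \<le> e * (v - u)" .
      qed
    qed
    have "(cdf \<nu> has_derivative (*) (f t)) (at t)"
      unfolding has_derivative_at_alt
    proof (intro conjI allI impI)
      show "bounded_linear ((*) (f t))" by (rule bounded_linear_mult_right)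
      fix e :: real assume "0 < e"
      from small[OF this] obtain d where d: "0 < d" "\<And>u v. u < v \<Longrightarrow> u \<le> t \<Longrightarrow> t \<le> v \<Longrightarrow> v - u < d \<Longrightarrow>
        \<bar>cdf \<nu> v - cdf \<nu> u - f t * (v - u)\<bar> \<le> e * (v - u)" by blast
      have "norm (cdf \<nu> y - cdf \<nu> t - f t * (y - t)) \<le> e * norm (y - t)" if "norm (y - t) < d" for y
        using d(2)[of y t] d(2)[of t y] that
        by (cases y t rule: linorder_cases) (auto simp: abs_le_iff algebra_simps)
      then show "\<exists>d>0. \<forall>y. norm (y - t) < d \<longrightarrow> norm (cdf \<nu> y - cdf \<nu> t - f t * (y - t)) \<le> e * norm (y - t)"
        using d(1) by blast
    qed
    then show "\<exists>p. (cdf \<nu> has_real_derivative p) (at t)"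
      unfolding has_field_derivative_def by blast
  qed
qed

section \<open>Distributions with connected support\<close>

text \<open>
  The complement of the support is a union of open null sets, and countably many of them suffice
  by Lindelof's theorem; so it is null.
\<close>

lemma msupp_Int_nonempty:
  fixes M :: "'a::second_countable_topology measure"
  assumes sets: "sets M = sets borel" and B: "0 < emeasure M B"
  shows "B \<inter> msupp M \<noteq> {}"
proof
  assume disj: "B \<inter> msupp M = {}"
  define \<F> where "\<F> = {U. open U \<and> emeasure M U = 0}"
  obtain \<F>' where \<F>': "\<F>' \<subseteq> \<F>" "countable \<F>'" "\<Union>\<F>' = \<Union>\<F>"
    using Lindelof[of \<F>] by (auto simp: \<F>_def)
  have sub: "B \<subseteq> \<Union>\<F>'"
  proof
    fix x assume "x \<in> B"
    then have "x \<notin> msupp M" using disj by blast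
    then obtain U where "open U" "x \<in> U" "emeasure M U = 0"
      unfolding msupp_def by (auto simp: zero_less_iff_neq_zero)
    then show "x \<in> \<Union>\<F>'" unfolding \<F>'(3) by (auto simp: \<F>_def)
  qed
  have null: "\<Union>\<F>' \<in> null_sets M"
  proof -
    have "U \<in> null_sets M" if "U \<in> \<F>'" for U
    proof (rule null_setsI)
      have "U \<in> \<F>" using that \<F>'(1) by blast
      then show "emeasure M U = 0" "U \<in> sets M" by (simp_all add: \<F>_def sets)
    qed
    then show ?thesis using null_sets_UN'[OF \<F>'(2), of "\<lambda>U. U" M] by simp
  qed
  have "emeasure M B \<le> emeasure M (\<Union>\<F>')"
    by (rule emeasure_mono[OF sub null_setsD2[OF null]])
  then show False using B null_setsD1[OF null] by simp
qed

text \<open>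
  The members of \<^const>\<open>class_V\<close>, set up as a locale so that the library facts on distribution
  functions are available.
\<close>

locale connected_ac_distribution= real_distribution \<nu> for \<nu> +
  assumes ac: "absolutely_continuous lborel \<nu>"
    and conn: "connected (msupp \<nu>)"
begin

lemma isCont_cdf_ac: "isCont (cdf \<nu>) x"
proof -
  have "{x} \<in> null_sets lborel" by (simp add: null_sets_def)
  then have "{x} \<in> null_sets \<nu>" using ac by (auto simp: absolutely_continuous_def)
  then show ?thesis by (simp add: isCont_cdf measure_eq_0_null_sets)
qed

lemma ex_msupp_le: "\<exists>x\<in>msupp \<nu>. x \<le> s" if "0 < cdf \<nu> s"
  using msupp_Int_nonempty[of \<nu> "{..s}"] that by (auto simp: cdf_def emeasure_eq_measure)

lemma ex_msupp_gt: "\<exists>x\<in>msupp \<nu>. s < x" if "cdf \<nu> s < 1"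
proof -
  have "prob (UNIV - {..s}) = 1 - prob {..s}" using prob_compl[of "{..s}"] by simp
  then have "0 < prob {s<..}" using that by (simp add: cdf_def Compl_eq_Diff_UNIV[symmetric])
  then show ?thesis
    using msupp_Int_nonempty[of \<nu> "{s<..}"] by (auto simp: emeasure_eq_measure)
qed

text \<open>
  Mass at or below \<open>s\<close> and mass above \<open>s\<close> produce points of the support on both sides, and the
  support has no gaps.
\<close>

lemma mem_msupp:
  assumes "0 < cdf \<nu> s" "cdf \<nu> s < 1"
  shows "s \<in> msupp \<nu>"
proof -
  obtain x y where "x \<in> msupp \<nu>" "x \<le> s" "y \<in> msupp \<nu>" "s < y"
    using ex_msupp_le[OF assms(1)] ex_msupp_gt[OF assms(2)] by blast
  then show ?thesis using connectedD_interval[OF conn] by (meson less_imp_le)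
qed

text \<open>
  Strictly between \<open>s\<close> and \<open>t\<close> there is a point of the support, so the interval between them has
  positive mass.
\<close>

lemma cdf_less:
  assumes "0 < cdf \<nu> s" "cdf \<nu> s < 1" "s < t"
  shows "cdf \<nu> s < cdf \<nu> t"
proof -
  obtain y where y: "y \<in> msupp \<nu>" "s < y" using ex_msupp_gt[OF assms(2)] by blast
  define z where "z = (s + min t y) / 2"
  have z: "s < z" "z < t" "z \<le> y" using y assms by (auto simp: z_def)
  have "z \<in> msupp \<nu>"
    using connectedD_interval[OF conn mem_msupp[OF assms(1,2)] y(1)] z by (simp add: less_imp_le)
  then have "0 < emeasure \<nu> {s<..<t}" using z by (auto simp: msupp_def)
  also have "\<dots> \<le> emeasure \<nu> {s<..t}" by (intro emeasure_mono) auto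
  finally show ?thesis using cdf_diff_eq[OF assms(3)] by (simp add: emeasure_eq_measure)
qed

text \<open>
  A point \<open>a\<close> of the support at which \<open>cdf \<nu>\<close> has been constant on the left is the left end of the
  support, and then \<open>cdf \<nu>\<close> is \<open>0\<close> there. Unlike in \<open>cdf_less\<close>, the value \<open>1\<close> is admitted at \<open>s\<close>.
\<close>

lemma cdf_less_msupp:
  assumes "0 < cdf \<nu> s" "a \<in> msupp \<nu>" "s < a"
  shows "cdf \<nu> s < cdf \<nu> a"
proof (cases "cdf \<nu> s < 1")
  case False
  then have "prob {..s} = 1" using prob_le_1[of "{..s}"] by (simp add: cdf_def)
  then have "prob (UNIV - {..s}) = 0" using prob_compl[of "{..s}"] by simp
  moreover have "0 < emeasure \<nu> {s<..}" using assms by (auto simp: msupp_def)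
  ultimately show ?thesis by (simp add: Compl_eq_Diff_UNIV[symmetric] emeasure_eq_measure)
qed (use cdf_less assms in blast)

lemma ex_cdf_eq:
  assumes "0 < p" "p < 1"
  shows "\<exists>t. cdf \<nu> t = p"
proof -
  obtain a where a: "cdf \<nu> a < p"
    using order_tendstoD(2)[OF cdf_lim_at_bot assms(1)]
    by (auto dest!: eventually_happens'[OF trivial_limit_at_bot_linorder])
  obtain b where b: "p < cdf \<nu> b"
    using order_tendstoD(1)[OF cdf_lim_at_top_prob assms(2)]
    by (auto dest!: eventually_happens'[OF trivial_limit_at_top_linorder])
  have "a \<le> b" using a b cdf_nondecreasing[of b a] by linarith
  then show ?thesis using IVT[of "cdf \<nu>" a p b] a b isCont_cdf_ac by auto
qed

lemma measurable_cdf [measurable]: "cdf \<nu> \<in> borel_measurable borel"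
  by (intro borel_measurable_mono monoI cdf_nondecreasing)

text \<open>
  The distribution of \<open>cdf \<nu>\<close> under \<open>\<nu>\<close> is uniform on \<open>[0, 1]\<close>, as for every atomless \<open>\<nu>\<close>.
\<close>

lemma prob_cdf_le:
  assumes "0 \<le> p" "p \<le> 1"
  shows "prob {t. cdf \<nu> t \<le> p} = p"
proof -
  have interior: "prob {t. cdf \<nu> t \<le> q} = q" if q: "0 < q" "q < 1" for q
  proof -
    obtain t where t: "cdf \<nu> t = q" using ex_cdf_eq[OF q] by blast
    have "s \<le> t" if "cdf \<nu> s \<le> q" for s
      using cdf_less[of t s] t q that by (cases "s \<le> t") auto
    then have "{s. cdf \<nu> s \<le> q} = {..t}" using t cdf_nondecreasing by auto
    then show ?thesis using t by (simp add: cdf_def)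
  qed
  consider "p = 0" | "0 < p" "p < 1" | "p = 1" using assms by linarith
  then show ?thesis
  proof cases
    \<comment> \<open>The set may be empty, so no point with value \<open>0\<close> is available; compare with small positive levels.\<close>
    case 1
    have "prob {t. cdf \<nu> t \<le> 0} \<le> 0"
    proof (rule field_le_epsilon)
      fix e :: real assume "0 < e"
      then have "prob {t. cdf \<nu> t \<le> 0} \<le> prob {t. cdf \<nu> t \<le> min e (1/2)}"
        by (intro finite_measure_mono) auto
      also have "\<dots> = min e (1/2)" using \<open>0 < e\<close> by (intro interior) auto
      finally show "prob {t. cdf \<nu> t \<le> 0} \<le> 0 + e" by simp
    qed
    then show ?thesis using 1 by (simp add: measure_le_0_iff)
  next
    case 3
    then show ?thesis using cdf_bounded_prob prob_space by simp
  qed (rule interior)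
qed

lemma AE_cdf_in_unit: "AE t in \<nu>. 0 < cdf \<nu> t \<and> cdf \<nu> t < 1"
proof -
  have "1 \<le> prob {t. cdf \<nu> t < 1}"
  proof (rule dense_le)
    fix q :: real assume q: "q < 1"
    have "q \<le> max q 0" by simp
    also have "\<dots> = prob {t. cdf \<nu> t \<le> max q 0}" using q by (intro prob_cdf_le[symmetric]) auto
    also have "\<dots> \<le> prob {t. cdf \<nu> t < 1}" using q by (intro finite_measure_mono) auto
    finally show "q \<le> prob {t. cdf \<nu> t < 1}" .
  qed
  then have "prob {t. cdf \<nu> t < 1} = 1" using prob_le_1 antisym by blast
  then have "AE t in \<nu>. t \<in> {t. cdf \<nu> t < 1}" by (subst AE_in_set_eq_1) auto
  moreover have "AE t in \<nu>. t \<notin> {t. cdf \<nu> t \<le> 0}"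
    using prob_cdf_le[of 0] by (intro AE_not_in) (auto simp: null_sets_def emeasure_eq_measure)
  ultimately show ?thesis by eventually_elim auto
qed

end

section \<open>Iso-dominants and the integral isoperimetric comparison\<close>

text \<open>
  McShane's extension formula with the distance \<open>\<bar>t - s\<bar>\<close> replaced by its positive part
  \<open>max (t - s) 0\<close>, which makes the extension monotone in addition.
\<close>

lemma mono_lipschitz_extension:
  fixes h :: "real \<Rightarrow> real"
  assumes ne: "S \<noteq> {}"
    and mono: "\<And>s t. s \<in> S \<Longrightarrow> t \<in> S \<Longrightarrow> s \<le> t \<Longrightarrow> h s \<le> h t"
    and lip: "\<And>s t. s \<in> S \<Longrightarrow> t \<in> S \<Longrightarrow> s \<le> t \<Longrightarrow> h t \<le> h s + (t - s)"
  obtains g where "mono g" "1-lipschitz_on UNIV g" "\<And>t. t \<in> S \<Longrightarrow> g t = h t"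
proof -
  define k where "k t s = h s + max (t - s) 0" for t s
  define g where "g t = (INF s\<in>S. k t s)" for t
  obtain s0 where s0: "s0 \<in> S" using ne by blast
  have bdd: "bdd_below (k t ` S)" for t
  proof (intro bdd_belowI2)
    fix s assume s: "s \<in> S"
    show "min (h s0) (h s0 - s0 + t) \<le> k t s"
      using mono[OF s0 s] lip[OF s s0] by (cases s s0 rule: linorder_cases) (auto simp: k_def)
  qed
  have g_le: "g t \<le> k t s" if "s \<in> S" for t s
    unfolding g_def by (rule cINF_lower[OF bdd that])
  have g_greatest: "c \<le> g t" if "\<And>s. s \<in> S \<Longrightarrow> c \<le> k t s" for c t
    unfolding g_def by (rule cINF_greatest[OF ne that])
  have g_mono: "g t \<le> g t'" if "t \<le> t'" for t t'
  proof (rule g_greatest)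
    fix s assume "s \<in> S"
    from g_le[OF this, of t] that show "g t \<le> k t' s" by (auto simp: k_def)
  qed
  have g_lip: "g t' - (t' - t) \<le> g t" if "t \<le> t'" for t t'
  proof (rule g_greatest)
    fix s assume "s \<in> S"
    from g_le[OF this, of t'] that show "g t' - (t' - t) \<le> k t s" by (auto simp: k_def)
  qed
  show ?thesis
  proof
    show "mono g" using g_mono by (rule monoI)
    show "1-lipschitz_on UNIV g"
    proof (rule lipschitz_onI)
      fix x y :: real
      show "dist (g x) (g y) \<le> 1 * dist x y"
        using g_mono[of x y] g_lip[of x y] g_mono[of y x] g_lip[of y x]
        by (cases "x \<le> y") (auto simp: dist_real_def)
    qed simp
    show "g t = h t" if t: "t \<in> S" for t
    proof (rule antisym)
      show "g t \<le> h t" using g_le[OF t, of t] by (simp add: k_def)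
      show "h t \<le> g t"
      proof (rule g_greatest)
        fix s assume s: "s \<in> S"
        show "h t \<le> k t s"
          using mono[OF t s] lip[OF s t] by (cases s t rule: linorder_cases) (auto simp: k_def)
      qed
    qed
  qed
qed

lemma lipschitz_imp_borel_measurable:
  fixes f :: "'a::metric_space \<Rightarrow> 'b::metric_space"
  assumes "sets M = sets borel" "L-lipschitz_on UNIV f"
  shows "f \<in> borel_measurable M"
proof -
  have "f \<in> borel_measurable borel"
    using assms(2) by (intro borel_measurable_continuous_onI lipschitz_on_continuous_on)
  then show ?thesis by (simp add: measurable_cong_sets[OF assms(1) refl])
qed

lemma measure_distr_atMost:
  fixes f :: "'a::topological_space \<Rightarrow> real"
  assumes "sets M = sets borel" "f \<in> borel_measurable M"
  shows "measure (distr M borel f) {..s} = measure M {x. f x \<le> s}"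
proof -
  have "space M = UNIV" using sets_eq_imp_space_eq[OF assms(1)] by simp
  then show ?thesis using assms(2) by (simp add: measure_distr vimage_def)
qed

lemma infdist_lipschitz: "1-lipschitz_on UNIV (\<lambda>x. infdist x A)"
  by (rule lipschitz_onI) (auto simp: dist_real_def infdist_triangle_abs)

text \<open>
  Moving by a distance \<open>r\<close> raises a 1-Lipschitz function by at most \<open>r\<close>.
\<close>

lemma measure_closed_nbhd_le_sublevel:
  fixes f :: "'a::metric_space \<Rightarrow> real"
  assumes "prob_space M" "sets M = sets borel" and f: "1-lipschitz_on UNIV f"
  shows "measure M (closed_nbhd r {x. f x \<le> s}) \<le> measure M {x. f x \<le> s + r}"
proof -
  interpret prob_space M by fact
  have [measurable]: "f \<in> borel_measurable M"
    by (rule lipschitz_imp_borel_measurable[OF assms(2) f])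
  have sp: "space M = UNIV" using sets_eq_imp_space_eq[OF assms(2)] by simp
  have "closed_nbhd r {x. f x \<le> s} \<subseteq> {x. f x \<le> s + r}"
  proof
    fix x assume "x \<in> closed_nbhd r {x. f x \<le> s}"
    then have ne: "{x. f x \<le> s} \<noteq> {}" and r: "infdist x {x. f x \<le> s} \<le> r"
      unfolding closed_nbhd_def by blast+
    have "f x - s \<le> (INF y\<in>{x. f x \<le> s}. dist x y)"
    proof (rule cINF_greatest[OF ne])
      fix y assume "y \<in> {x. f x \<le> s}"
      moreover have "\<bar>f x - f y\<bar> \<le> dist x y"
        using lipschitz_onD[OF f, of x y] by (simp add: dist_real_def)
      ultimately show "f x - s \<le> dist x y" by auto
    qed
    then show "x \<in> {x. f x \<le> s + r}" using r ne by (simp add: infdist_notempty)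
  qed
  moreover have "{x \<in> space M. f x \<le> s + r} \<in> sets M" by measurable
  ultimately show ?thesis by (intro finite_measure_mono) (auto simp: sp)
qed

context connected_ac_distribution
begin

text \<open>
  The dominance is applied to the distance function \<open>f\<close> from \<open>A\<close>. The lower bound \<open>V a\<close> for the
  mass of \<open>A\<close>, hence for that of \<open>{h \<le> 0}\<close>, forces \<open>h a \<le> 0\<close>: otherwise \<open>h\<close> is positive already
  beyond some \<open>s < a\<close>, and the mass of \<open>{h \<le> 0}\<close> is at most \<open>V s < V a\<close>. Then \<open>h \<le> b - a\<close> on \<open>(-\<infinity>, b]\<close>, and the
  two sublevel sets at level \<open>b - a\<close> have the same mass.
\<close>

theorem iso_dominant_imp_ICL:
  fixes M :: "'a::metric_space measure"
  assumes M: "prob_space M" "sets M = sets borel" and iso: "iso_dominant \<nu> M"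
  shows "ICL M \<nu>"
  unfolding ICL_def
proof (intro ballI impI, elim conjE)
  interpret M: prob_space M by fact
  fix a b and A :: "'a set"
  assume a: "a \<in> msupp \<nu>" and A: "A \<in> sets borel" and ab: "a \<le> b"
    and posA: "0 < measure M A" and Va: "cdf \<nu> a \<le> measure M A"
  have ne: "A \<noteq> {}" using posA by auto
  let ?f = "\<lambda>x. infdist x A"
  obtain h where h: "mono h" "1-lipschitz_on UNIV h" "distr M borel ?f = distr \<nu> borel h"
    using iso infdist_lipschitz unfolding iso_dominant_def by blast
  have h_meas [measurable]: "h \<in> borel_measurable borel"
    using lipschitz_imp_borel_measurable[OF refl h(2)] .
  have f_meas: "?f \<in> borel_measurable M"
    by (rule lipschitz_imp_borel_measurable[OF M(2) infdist_lipschitz])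
  have sublevel: "measure M {x. ?f x \<le> s} = prob {t. h t \<le> s}" for s
    using measure_distr_atMost[OF M(2) f_meas] measure_distr_atMost[OF events_eq_borel, of h] h(3)
    by simp
  have sets_f: "{x. ?f x \<le> s} \<in> sets M" for s
    using M(2) by (simp add: closed_Collect_le continuous_on_infdist borel_closed)
  have A_le: "measure M A \<le> prob {t. h t \<le> 0}"
    unfolding sublevel[symmetric] using sets_f by (intro M.finite_measure_mono) auto
  have ha: "h a \<le> 0"
  proof (rule ccontr)
    assume pos: "\<not> h a \<le> 0"
    \<comment> \<open>The Lipschitz bound keeps \<open>h\<close> above \<open>h a / 2\<close> between \<open>s\<close> and \<open>a\<close>.\<close>
    define s where "s = a - h a / 2"
    have "t \<le> s" if "h t \<le> 0" for t
    proof (rule ccontr)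
      assume "\<not> t \<le> s"
      moreover have "t \<le> a" using that pos monoD[OF h(1), of a t] by linarith
      ultimately have "\<bar>h a - h t\<bar> \<le> h a / 2"
        using lipschitz_onD[OF h(2), of a t] by (simp add: s_def dist_real_def)
      then show False using that pos by linarith
    qed
    then have "prob {t. h t \<le> 0} \<le> cdf \<nu> s"
      unfolding cdf_def by (intro finite_measure_mono) auto
    moreover have "s < a" using pos by (simp add: s_def)
    ultimately show False
      using cdf_less_msupp[OF _ a, of s] A_le posA Va by linarith
  qed
  have "cdf \<nu> b \<le> prob {t. h t \<le> b - a}"
    unfolding cdf_def
  proof (intro finite_measure_mono)
    show "{..b} \<subseteq> {t. h t \<le> b - a}"
    proof
      fix t assume "t \<in> {..b}"
      then have "h t \<le> h b" using h(1) by (simp add: monoD)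
      also have "h b \<le> h a + (b - a)"
        using lipschitz_onD[OF h(2), of b a] ab by (simp add: dist_real_def)
      finally show "t \<in> {t. h t \<le> b - a}" using ha by simp
    qed
  qed simp
  also have "\<dots> = measure M (closed_nbhd (b - a) A)"
    using ne by (simp add: sublevel[symmetric] closed_nbhd_def)
  finally show "cdf \<nu> b \<le> measure M (closed_nbhd (b - a) A)" .
qed

text \<open>
  The monotone rearrangement \<open>t \<mapsto> D.I (cdf \<nu> t)\<close>, where \<open>D.I\<close> is the quantile function of the
  distribution of \<open>f\<close>, has the right image measure. By \<open>ICL\<close>, applied to the sublevel set of \<open>f\<close> at
  the level that it takes at \<open>a\<close>, it is 1-Lipschitz where \<open>cdf \<nu>\<close> lies strictly between \<open>0\<close> and \<open>1\<close>; outside this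
  \<open>\<nu>\<close>-full set \<open>D.I\<close> may be the infimum of an empty or unbounded set, and the extension lemma
  takes over.
\<close>

theorem ICL_imp_iso_dominant:
  fixes M :: "'a::metric_space measure"
  assumes M: "prob_space M" "sets M = sets borel" and icl: "ICL M \<nu>"
  shows "iso_dominant \<nu> M"
  unfolding iso_dominant_def
proof (intro allI impI)
  interpret M: prob_space M by fact
  fix f :: "'a \<Rightarrow> real" assume f: "1-lipschitz_on UNIV f"
  have f_meas: "f \<in> borel_measurable M"
    by (rule lipschitz_imp_borel_measurable[OF M(2) f])
  interpret D: cdf_distribution "distr M borel f"
    unfolding cdf_distribution_def by (rule M.real_distribution_distr[OF f_meas])
  have C_eq: "D.C s = measure M {x. f x \<le> s}" for s
    unfolding cdf_def by (rule measure_distr_atMost[OF M(2) f_meas])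
  define S where "S = {t. 0 < cdf \<nu> t \<and> cdf \<nu> t < 1}"
  have quantile: "cdf \<nu> t \<le> D.C s \<longleftrightarrow> D.I (cdf \<nu> t) \<le> s" if "t \<in> S" for t s
    by (rule D.pseudoinverse) (use that in \<open>auto simp: S_def\<close>)
  have le_quantile: "cdf \<nu> t \<le> D.C (D.I (cdf \<nu> t))" if "t \<in> S" for t
    by (rule iffD2[OF quantile[OF that] order_refl])
  obtain t where "cdf \<nu> t = 1 / 2" using ex_cdf_eq[of "1 / 2"] by auto
  then have "t \<in> S" by (simp add: S_def)
  then have "S \<noteq> {}" by blast
  then obtain h where h: "mono h" "1-lipschitz_on UNIV h" "\<And>t. t \<in> S \<Longrightarrow> h t = D.I (cdf \<nu> t)"
  proof (rule mono_lipschitz_extension)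
    fix a b assume ab: "a \<in> S" "b \<in> S" "a \<le> b"
    have "cdf \<nu> a \<le> cdf \<nu> b" by (rule cdf_nondecreasing[OF ab(3)])
    also have "\<dots> \<le> D.C (D.I (cdf \<nu> b))" by (rule le_quantile[OF ab(2)])
    finally show "D.I (cdf \<nu> a) \<le> D.I (cdf \<nu> b)" by (rule iffD1[OF quantile[OF ab(1)]])
    let ?s = "D.I (cdf \<nu> a)"
    let ?A = "{x. f x \<le> ?s}"
    have A: "?A \<in> sets borel"
      using lipschitz_on_continuous_on[OF f] by (intro borel_closed closed_Collect_le) auto
    have Va: "0 < cdf \<nu> a" "cdf \<nu> a \<le> measure M ?A"
      using le_quantile[OF ab(1)] ab(1) by (auto simp: C_eq S_def)
    have "cdf \<nu> b \<le> measure M (closed_nbhd (b - a) ?A)"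
      using icl mem_msupp ab A Va unfolding ICL_def S_def by auto
    also have "\<dots> \<le> D.C (?s + (b - a))"
      unfolding C_eq by (rule measure_closed_nbhd_le_sublevel[OF M f])
    finally show "D.I (cdf \<nu> b) \<le> ?s + (b - a)" by (rule iffD1[OF quantile[OF ab(2)]])
  qed blast
  have h_meas [measurable]: "h \<in> borel_measurable borel"
    using lipschitz_imp_borel_measurable[OF refl h(2)] .
  have "distr \<nu> borel h = distr M borel f"
  proof (rule cdf_unique)
    show "cdf (distr \<nu> borel h) = D.C"
    proof
      fix s
      have "cdf (distr \<nu> borel h) s = prob {t. h t \<le> s}"
        unfolding cdf_def by (rule measure_distr_atMost) simp_all
      also have "\<dots> = prob {t. cdf \<nu> t \<le> D.C s}"
      proof (rule finite_measure_eq_AE)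
        show "AE t in \<nu>. (t \<in> {t. h t \<le> s}) = (t \<in> {t. cdf \<nu> t \<le> D.C s})"
          using AE_cdf_in_unit
        proof eventually_elim
          fix t assume "0 < cdf \<nu> t \<and> cdf \<nu> t < 1"
          then have t: "t \<in> S" by (simp add: S_def)
          show "(t \<in> {t. h t \<le> s}) = (t \<in> {t. cdf \<nu> t \<le> D.C s})"
            unfolding mem_Collect_eq h(3)[OF t] by (rule quantile[OF t, symmetric])
        qed
      qed simp_all
      also have "\<dots> = D.C s"
        using D.cdf_nonneg D.cdf_bounded_prob by (rule prob_cdf_le)
      finally show "cdf (distr \<nu> borel h) s = D.C s" .
    qed
  qed (auto intro: D.real_distribution_axioms)
  then show "\<exists>h. mono h \<and> 1-lipschitz_on UNIV h \<and> distr M borel f = distr \<nu> borel h"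
    using h by metis
qed

end

section \<open>From the integral to the infinitesimal comparison\<close>

lemma open_open_nbhd: "open (open_nbhd r A)"
proof -
  have "open_nbhd r A = (\<Union>a\<in>A. ball a r)" by (auto simp: open_nbhd_def dist_commute)
  then show ?thesis by auto
qed

lemma closed_closed_nbhd: "closed (closed_nbhd r A)"
  by (cases "A = {}") (auto simp: closed_nbhd_def intro!: closed_Collect_le continuous_intros)

lemma closed_nbhd_subset_open_nbhd:
  assumes "s < r"
  shows "closed_nbhd s A \<subseteq> open_nbhd r A"
proof
  fix x assume "x \<in> closed_nbhd s A"
  then have ne: "A \<noteq> {}" and "infdist x A \<le> s" by (auto simp: closed_nbhd_def)
  then have "(INF a\<in>A. dist x a) < r" using assms by (simp add: infdist_notempty)
  then obtain a where "a \<in> A" "dist x a < r"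
    by (subst (asm) cINF_less_iff) (use ne in \<open>auto intro: bdd_belowI2[of _ 0]\<close>)
  then show "x \<in> open_nbhd r A" by (auto simp: open_nbhd_def)
qed

lemma open_nbhd_closed_nbhd_subset: "open_nbhd s (closed_nbhd r A) \<subseteq> closed_nbhd (r + s) A"
proof
  fix x assume "x \<in> open_nbhd s (closed_nbhd r A)"
  then obtain y where y: "A \<noteq> {}" "infdist y A \<le> r" "dist x y < s"
    by (auto simp: open_nbhd_def closed_nbhd_def)
  have "infdist x A \<le> infdist y A + dist x y" by (rule infdist_triangle)
  then show "x \<in> closed_nbhd (r + s) A" using y by (simp add: closed_nbhd_def)
qed

lemma boundary_measure_nonneg:
  assumes "finite_measure M" "sets M = sets borel"
  shows "0 \<le> boundary_measure M A"
  unfolding boundary_measure_def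
proof (rule le_Limsup)
  interpret finite_measure M by fact
  show "\<forall>\<^sub>F \<epsilon> in at_right 0. 0 \<le> ereal ((measure M (open_nbhd \<epsilon> A) - measure M A) / \<epsilon>)"
    using eventually_at_right_less[of "0::real"]
  proof eventually_elim
    fix \<epsilon> :: real assume "0 < \<epsilon>"
    then have "x \<in> open_nbhd \<epsilon> A" if "x \<in> A" for x
      using that by (auto simp: open_nbhd_def intro!: bexI[of _ x])
    then have "A \<subseteq> open_nbhd \<epsilon> A" by blast
    then have "measure M A \<le> measure M (open_nbhd \<epsilon> A)"
      using assms(2) by (intro finite_measure_mono) (simp_all add: open_open_nbhd)
    then show "0 \<le> ereal ((measure M (open_nbhd \<epsilon> A) - measure M A) / \<epsilon>)"
      using \<open>0 < \<epsilon>\<close> by simp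
  qed
qed simp

text \<open>
  The boundary measure of a closed neighbourhood bounds the upper right derivative of
  \<open>r \<mapsto> measure M (closed_nbhd r A)\<close> from below, by the triangle inequality.
\<close>

lemma boundary_measure_closed_nbhd_witness:
  assumes "finite_measure M" "sets M = sets borel"
    and m: "ereal m < boundary_measure M (closed_nbhd r A)" and d: "0 < d"
  obtains \<epsilon> where "0 < \<epsilon>" "\<epsilon> < d"
    "m * \<epsilon> < measure M (closed_nbhd (r + \<epsilon>) A) - measure M (closed_nbhd r A)"
proof -
  interpret finite_measure M by fact
  let ?q = "\<lambda>\<epsilon>. (measure M (open_nbhd \<epsilon> (closed_nbhd r A)) - measure M (closed_nbhd r A)) / \<epsilon>"
  have "\<not> (\<forall>\<^sub>F \<epsilon> in at_right 0. ereal (?q \<epsilon>) \<le> ereal m)"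
    using Limsup_bounded[of "\<lambda>\<epsilon>. ereal (?q \<epsilon>)" "ereal m" "at_right 0"] m
    by (auto simp: boundary_measure_def)
  then have "\<not> (\<forall>\<epsilon>>0. \<epsilon> < d \<longrightarrow> ?q \<epsilon> \<le> m)"
    using d unfolding eventually_at_right_field by auto
  then obtain \<epsilon> where \<epsilon>: "0 < \<epsilon>" "\<epsilon> < d" "m < ?q \<epsilon>" by (auto simp: not_le)
  have "m * \<epsilon> < measure M (open_nbhd \<epsilon> (closed_nbhd r A)) - measure M (closed_nbhd r A)"
    using \<epsilon> by (simp add: pos_less_divide_eq)
  moreover have "measure M (open_nbhd \<epsilon> (closed_nbhd r A)) \<le> measure M (closed_nbhd (r + \<epsilon>) A)"
    using assms(2)
    by (intro finite_measure_mono open_nbhd_closed_nbhd_subset) (simp add: closed_closed_nbhd borel_closed)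
  ultimately show ?thesis using that \<epsilon> by force
qed

context connected_ac_distribution
begin

text \<open>
  \<open>ICL\<close> speaks of closed neighbourhoods and the boundary measure of open ones. The step from radii
  smaller than \<open>\<epsilon>\<close> to \<open>\<epsilon>\<close> itself uses the continuity of \<open>cdf \<nu>\<close>.
\<close>

lemma cdf_le_open_nbhd:
  fixes M :: "'a::metric_space measure"
  assumes M: "prob_space M" "sets M = sets borel" and icl: "ICL M \<nu>"
    and A: "A \<in> sets borel" "measure M A = cdf \<nu> t"
    and t: "0 < cdf \<nu> t" and \<epsilon>: "0 < \<epsilon>" "cdf \<nu> (t + \<epsilon>) < 1"
  shows "cdf \<nu> (t + \<epsilon>) \<le> measure M (open_nbhd \<epsilon> A)"
proof (rule tendsto_upperbound)
  interpret M: prob_space M by fact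
  show "(cdf \<nu> \<longlongrightarrow> cdf \<nu> (t + \<epsilon>)) (at_left (t + \<epsilon>))"
    using isCont_cdf_ac[of "t + \<epsilon>"] by (simp add: continuous_at_imp_continuous_within continuous_within[symmetric])
  have "\<forall>\<^sub>F s in at_left (t + \<epsilon>). s \<in> {t<..<t + \<epsilon>}"
    using \<epsilon> by (intro eventually_at_left_real) simp
  then show "\<forall>\<^sub>F s in at_left (t + \<epsilon>). cdf \<nu> s \<le> measure M (open_nbhd \<epsilon> A)"
  proof eventually_elim
    fix s assume s: "s \<in> {t<..<t + \<epsilon>}"
    have bounds: "cdf \<nu> t \<le> cdf \<nu> s" "cdf \<nu> s \<le> cdf \<nu> (t + \<epsilon>)"
      using s by (auto intro: cdf_nondecreasing)
    have "t \<in> msupp \<nu>" "s \<in> msupp \<nu>" using bounds t \<epsilon> by (auto intro!: mem_msupp)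
    then have "cdf \<nu> s \<le> measure M (closed_nbhd (s - t) A)"
      using icl A t s unfolding ICL_def by auto
    also have "\<dots> \<le> measure M (open_nbhd \<epsilon> A)"
      using s M(2) by (intro M.finite_measure_mono closed_nbhd_subset_open_nbhd) (auto simp: open_open_nbhd)
    finally show "cdf \<nu> s \<le> measure M (open_nbhd \<epsilon> A)" .
  qed
qed simp

text \<open>
  At a point \<open>t\<close> of differentiability, the difference quotients of \<open>V\<close> are bounded by those in the
  definition of the boundary measure of any \<open>A\<close> with mass \<open>V t\<close>. Where \<open>V t\<close> is \<open>0\<close> or \<open>1\<close> the
  point \<open>t\<close> need not belong to the support, but there \<open>V\<close> has an extremum and its derivative is \<open>0\<close>.
\<close>

theorem ICL_imp_IC:
  fixes M :: "'a::metric_space measure"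
  assumes M: "prob_space M" "sets M = sets borel" and icl: "ICL M \<nu>"
  shows "IC M \<nu>"
  unfolding IC_def
  using AE_cdf_differentiable[OF finite_measure_axioms events_eq_borel ac]
proof (eventually_elim, intro impI)
  interpret M: prob_space M by fact
  fix t assume "\<exists>p. (cdf \<nu> has_real_derivative p) (at t)"
  then obtain p where p: "(cdf \<nu> has_real_derivative p) (at t)" by blast
  have "ereal p \<le> boundary_measure M A" if A: "A \<in> sets borel" "measure M A = cdf \<nu> t" for A
  proof -
    consider "cdf \<nu> t = 0" | "cdf \<nu> t = 1" | "0 < cdf \<nu> t" "cdf \<nu> t < 1"
      using cdf_nonneg[of t] cdf_bounded_prob[of t] by linarith
    then show ?thesis
    proof cases
      case 1
      then have "p = 0" using DERIV_local_min[OF p, of 1] cdf_nonneg by simp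
      then show ?thesis
        using boundary_measure_nonneg[OF M.finite_measure_axioms M(2)] by (simp add: zero_ereal_def)
    next
      case 2
      then have "p = 0" using DERIV_local_max[OF p, of 1] cdf_bounded_prob by simp
      then show ?thesis
        using boundary_measure_nonneg[OF M.finite_measure_axioms M(2)] by (simp add: zero_ereal_def)
    next
      case 3
      have "((\<lambda>\<epsilon>. (cdf \<nu> (t + \<epsilon>) - cdf \<nu> t) / \<epsilon>) \<longlongrightarrow> p) (at_right 0)"
        using p unfolding DERIV_def by (rule tendsto_within_subset) simp
      then have "((\<lambda>\<epsilon>. ereal ((cdf \<nu> (t + \<epsilon>) - cdf \<nu> t) / \<epsilon>)) \<longlongrightarrow> ereal p) (at_right 0)"
        by simp
      then have "ereal p = Limsup (at_right 0) (\<lambda>\<epsilon>. ereal ((cdf \<nu> (t + \<epsilon>) - cdf \<nu> t) / \<epsilon>))"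
        by (intro lim_imp_Limsup[symmetric]) simp_all
      also have "\<dots> \<le> boundary_measure M A"
        unfolding boundary_measure_def
      proof (rule Limsup_mono)
        have "((\<lambda>\<epsilon>. cdf \<nu> (t + \<epsilon>)) \<longlongrightarrow> cdf \<nu> t) (at_right 0)"
          using isCont_cdf_ac[of t] unfolding isCont_iff by (rule tendsto_within_subset) simp
        from order_tendstoD(2)[OF this 3(2)] eventually_at_right_less[of "0::real"]
        show "\<forall>\<^sub>F \<epsilon> in at_right 0. ereal ((cdf \<nu> (t + \<epsilon>) - cdf \<nu> t) / \<epsilon>)
            \<le> ereal ((measure M (open_nbhd \<epsilon> A) - measure M A) / \<epsilon>)"
        proof eventually_elim
          fix \<epsilon> :: real assume "cdf \<nu> (t + \<epsilon>) < 1" "0 < \<epsilon>"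
          then show "ereal ((cdf \<nu> (t + \<epsilon>) - cdf \<nu> t) / \<epsilon>)
            \<le> ereal ((measure M (open_nbhd \<epsilon> A) - measure M A) / \<epsilon>)"
            using cdf_le_open_nbhd[OF M icl A 3(1)] A(2) by (simp add: divide_right_mono)
        qed
      qed
      finally show ?thesis .
    qed
  qed
  then show "ereal (deriv (cdf \<nu>) t) \<le> isoperimetric_profile M (cdf \<nu> t)"
    unfolding isoperimetric_profile_def DERIV_imp_deriv[OF p] by (auto intro: INF_greatest)
qed

end

section \<open>From the infinitesimal to the integral comparison\<close>

context connected_ac_distribution
begin

text \<open>
  Suppose \<open>ICL\<close> fails for \<open>a\<close>, \<open>b\<close> and \<open>A\<close>, and let \<open>T r\<close> be the point at which \<open>V\<close> takes the
  value \<open>g r\<close>, the mass of the closed \<open>r\<close>-neighbourhood of \<open>A\<close>. Then \<open>a \<le> T 0\<close> and \<open>T L < b\<close> with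
  \<open>L = b - a\<close>. The contradiction is \<open>L \<le> T L - T 0\<close>, obtained from the covering lemma with Lebesgue
  measure and factors \<open>c < 1\<close> once the set \<open>R\<close> of radii with \<open>T r\<close> in the exceptional null set is
  known to be null. For the latter, the covering lemma is used with \<open>\<nu>\<close> itself, because
  \<open>\<nu> (T u, T v] = g v - g u\<close>.
\<close>

theorem IC_imp_ICL:
  fixes M :: "'a::metric_space measure"
  assumes M: "prob_space M" "sets M = sets borel" and ec: "essentially_connected M"
    and ic: "IC M \<nu>"
  shows "ICL M \<nu>"
  unfolding ICL_def
proof (intro ballI impI, elim conjE, rule ccontr)
  interpret M: prob_space M by fact
  fix a b and A :: "'a set"
  assume a: "a \<in> msupp \<nu>" and A: "A \<in> sets borel" and ab: "a \<le> b"
    and posA: "0 < measure M A" and Va: "cdf \<nu> a \<le> measure M A"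
  define g where "g r = measure M (closed_nbhd r A)" for r
  define L where "L = b - a"
  assume "\<not> cdf \<nu> b \<le> measure M (closed_nbhd (b - a) A)"
  then have gL: "g L < cdf \<nu> b" by (simp add: g_def L_def)
  have ne: "A \<noteq> {}" using posA by auto
  have nbhd_sets: "closed_nbhd r A \<in> sets borel" for r
    by (simp add: closed_closed_nbhd borel_closed)
  have dist_meas: "(\<lambda>x. infdist x A) \<in> borel_measurable M"
    by (simp add: measurable_cong_sets[OF M(2) refl] borel_measurable_continuous_onI continuous_on_infdist)
  \<comment> \<open>As a distribution function, \<open>g\<close> inherits monotonicity and right continuity.\<close>
  interpret D: real_distribution "distr M borel (\<lambda>x. infdist x A)"
    by (rule M.real_distribution_distr[OF dist_meas])
  have "space M = UNIV" using sets_eq_imp_space_eq[OF M(2)] by simp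
  then have g_cdf: "g = cdf (distr M borel (\<lambda>x. infdist x A))"
    using ne dist_meas by (auto simp: g_def closed_nbhd_def cdf_def measure_distr vimage_def fun_eq_iff)
  have g_mono: "g r \<le> g s" if "r \<le> s" for r s
    unfolding g_cdf by (rule D.cdf_nondecreasing[OF that])
  have A_le: "measure M A \<le> g 0"
    unfolding g_def using nbhd_sets M(2)
    by (intro M.finite_measure_mono) (auto simp: closed_nbhd_def)
  have ab_less: "0 < L"
  proof (rule ccontr)
    assume "\<not> 0 < L"
    then have "b = a" "L = 0" using ab by (auto simp: L_def)
    then show False using gL A_le Va by simp
  qed
  have g_unit: "0 < g r" "g r < 1" if "r \<in> {0..L}" for r
    using that g_mono[of 0 r] g_mono[of r L] A_le posA gL cdf_bounded_prob[of b] by auto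
  define T where "T r = (SOME t. cdf \<nu> t = g r)" for r
  have T: "cdf \<nu> (T r) = g r" if "r \<in> {0..L}" for r
    unfolding T_def by (rule someI_ex[OF ex_cdf_eq[OF g_unit[OF that]]])
  have T_less: "T r < t" if "r \<in> {0..L}" "g r < cdf \<nu> t" for r t
    using cdf_nondecreasing[of t "T r"] T[OF that(1)] that(2) by linarith
  have T_mono: "T r \<le> T s" if "r \<in> {0..L}" "s \<in> {0..L}" "r \<le> s" for r s
  proof (rule ccontr)
    assume "\<not> T r \<le> T s"
    then have "cdf \<nu> (T s) < cdf \<nu> (T r)"
      using T g_unit that by (intro cdf_less) auto
    then show False using T g_mono that by fastforce
  qed
  have mono_T: "mono_on {0..L} T" using T_mono by (auto simp: mono_on_def)
  have T_range: "a \<le> T 0" "T L < b"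
  proof -
    show "a \<le> T 0"
    proof (rule ccontr)
      assume "\<not> a \<le> T 0"
      then have "cdf \<nu> (T 0) < cdf \<nu> a"
        using T[of 0] g_unit[of 0] ab_less a by (intro cdf_less_msupp) auto
      then show False using T[of 0] ab_less A_le Va by simp
    qed
    show "T L < b" using T_less[of L b] ab_less gL by simp
  qed
  \<comment> \<open>\<open>g\<close> is right continuous and \<open>V\<close> is strictly increasing at \<open>T r\<close>.\<close>
  have T_right_cont: "\<exists>d>0. \<forall>s\<in>{0..L}. r < s \<and> s < r + d \<longrightarrow> T s < T r + e"
    if r: "r \<in> {0..L}" and e: "0 < e" for r e
  proof -
    have "(g \<longlongrightarrow> g r) (at_right r)"
      using D.cdf_is_right_cont[of r] unfolding g_cdf continuous_within .
    moreover have "g r < cdf \<nu> (T r + e)"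
      using cdf_less[of "T r" "T r + e"] T[OF r] g_unit[OF r] e by simp
    ultimately have "\<forall>\<^sub>F s in at_right r. g s < cdf \<nu> (T r + e)"
      by (rule order_tendstoD)
    then obtain c where "r < c" "\<And>s. r < s \<Longrightarrow> s < c \<Longrightarrow> g s < cdf \<nu> (T r + e)"
      unfolding eventually_at_right_field by blast
    then show ?thesis using T_less by (intro exI[of _ "c - r"]) auto
  qed
  have prob_Ioc_T: "prob {T u<..T v} = g v - g u" if "u \<in> {0..L}" "v \<in> {0..L}" "u \<le> v" for u v
    using T_mono[OF that] cdf_diff_eq[of "T u" "T v"] T[OF that(1)] T[OF that(2)]
    by (cases "T u = T v") auto
  \<comment> \<open>The only use of essential connectedness.\<close>
  have bd_pos: "0 < boundary_measure M (closed_nbhd r A)" if "r \<in> {0..L}" for r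
    using ec g_unit[OF that] closed_closed_nbhd unfolding essentially_connected_def g_def by blast
  define P where "P t \<longleftrightarrow> (\<exists>p. (cdf \<nu> has_real_derivative p) (at t)) \<and>
      (cdf \<nu> t \<in> Im_measure M \<longrightarrow>
        ereal (deriv (cdf \<nu>) t) \<le> isoperimetric_profile M (cdf \<nu> t))" for t
  have "AE t in lborel. P t"
    using AE_cdf_differentiable[OF finite_measure_axioms events_eq_borel ac] ic
    unfolding IC_def P_def by eventually_elim simp
  from AE_E[OF this] obtain N where N: "emeasure lborel N = 0" "N \<in> sets lborel"
    and bad: "{t \<in> space lborel. \<not> P t} \<subseteq> N" by blast
  have good: "P t" if "t \<notin> N" for t using bad that by auto
  have N_null: "emeasure \<nu> N = 0"
    using ac N unfolding absolutely_continuous_def null_sets_def by auto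
  define R where "R = {r \<in> {0..<L}. T r \<in> N}"
  \<comment> \<open>The upper right derivative of \<open>g\<close> is positive, but without a uniform lower bound; hence the pieces \<open>Rn n\<close>.\<close>
  define Rn where "Rn n = {r \<in> R. \<forall>d>0. \<exists>\<epsilon>. 0 < \<epsilon> \<and> \<epsilon> < d \<and> 1 / Suc n * \<epsilon> < g (r + \<epsilon>) - g r}"
    for n
  have "negligible (Rn n)" for n
  proof (rule negligible_expanding_preimage[OF finite_measure_axioms events_eq_borel _ N_null _ mono_T])
    show "N \<in> sets borel" using N by simp
    show "T ` Rn n \<subseteq> N" by (auto simp: Rn_def R_def)
    show "(0::real) < 1 / Suc n" by simp
    fix r d :: real and Q :: "real set" assume r: "r \<in> Rn n" and d: "0 < d" and Q: "open Q" "T r \<in> Q"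
    have rL: "r \<in> {0..<L}" using r by (auto simp: Rn_def R_def)
    obtain e where e: "0 < e" "ball (T r) e \<subseteq> Q" using Q by (meson openE)
    obtain d' where d': "0 < d'" "\<And>s. s \<in> {0..L} \<Longrightarrow> r < s \<Longrightarrow> s < r + d' \<Longrightarrow> T s < T r + e"
      using T_right_cont[of r e] rL e by auto
    have "0 < min d (min d' (L - r))" using d d' rL by simp
    then obtain \<epsilon> where \<epsilon>: "0 < \<epsilon>" "\<epsilon> < min d (min d' (L - r))" "1 / Suc n * \<epsilon> < g (r + \<epsilon>) - g r"
      using r unfolding Rn_def by blast
    have in_dom: "r \<in> {0..L}" "r + \<epsilon> \<in> {0..L}" using \<epsilon> rL by auto
    have "T (r + \<epsilon>) < T r + e" using d'(2)[OF in_dom(2)] \<epsilon> by simp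
    then have "{T r<..T (r + \<epsilon>)} \<subseteq> ball (T r) e" by (auto simp: dist_real_def)
    then have "{T r<..T (r + \<epsilon>)} \<subseteq> Q" using e by blast
    moreover have "1 / Suc n * \<epsilon> \<le> prob {T r<..T (r + \<epsilon>)}"
      using prob_Ioc_T[OF in_dom] \<epsilon> by simp
    ultimately show "\<exists>u\<in>{0..L}. \<exists>v\<in>{0..L}. u < v \<and> u \<le> r \<and> r \<le> v \<and> v - u < d \<and>
        {T u<..T v} \<subseteq> Q \<and> 1 / Suc n * (v - u) \<le> prob {T u<..T v}"
      using in_dom \<epsilon> by (intro bexI[of _ r] bexI[of _ "r + \<epsilon>"]) auto
  qed
  then have "negligible (\<Union>n. Rn n)" by (rule negligible_Union_nat)
  moreover have "R \<subseteq> (\<Union>n. Rn n)"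
  proof
    fix r assume r: "r \<in> R"
    then have rL: "r \<in> {0..L}" by (auto simp: R_def)
    obtain m where m: "0 < ereal m" "ereal m < boundary_measure M (closed_nbhd r A)"
      using ereal_dense2[OF bd_pos[OF rL]] by blast
    then have "0 < m" by simp
    from reals_Archimedean[OF this] obtain n where n: "1 / Suc n < m" by (auto simp: inverse_eq_divide)
    have "\<exists>\<epsilon>. 0 < \<epsilon> \<and> \<epsilon> < d \<and> 1 / Suc n * \<epsilon> < g (r + \<epsilon>) - g r" if d: "0 < d" for d
    proof -
      obtain \<epsilon> where \<epsilon>: "0 < \<epsilon>" "\<epsilon> < d" "m * \<epsilon> < g (r + \<epsilon>) - g r"
        using boundary_measure_closed_nbhd_witness[OF M.finite_measure_axioms M(2) m(2) d]
        unfolding g_def by blast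
      have "1 / Suc n * \<epsilon> < m * \<epsilon>" using n \<epsilon>(1) by (rule mult_strict_right_mono)
      then show ?thesis using \<epsilon> by force
    qed
    then show "r \<in> (\<Union>n. Rn n)" using r by (auto simp: Rn_def)
  qed
  ultimately have R_negl: "negligible R" by (rule negligible_subset)
  have "L \<le> T L - T 0"
  proof (rule field_le_mult_one_interval)
    fix c :: real assume c: "0 < c" "c < 1"
    obtain B where B: "B \<in> sets borel" "negligible ({0..<L} - R - B)"
      "ennreal c * emeasure lborel B \<le> emeasure lborel {T 0<..T L}"
    proof (rule vitali_cover_monotone_image[OF sets_lborel _ mono_T c(1)])
      fix r d :: real assume r: "r \<in> {0..<L} - R" and d: "0 < d"
      then have rL: "r \<in> {0..L}" and "r < L" and "T r \<notin> N" by (auto simp: R_def)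
      from good[OF this(3)] obtain p where p: "(cdf \<nu> has_real_derivative p) (at (T r))"
        and prof: "cdf \<nu> (T r) \<in> Im_measure M \<Longrightarrow>
          ereal (deriv (cdf \<nu>) (T r)) \<le> isoperimetric_profile M (cdf \<nu> (T r))"
        unfolding P_def by blast
      have "g r \<in> Im_measure M" using nbhd_sets by (auto simp: g_def Im_measure_def)
      then have "ereal p \<le> isoperimetric_profile M (g r)"
        using prof T[OF rL] DERIV_imp_deriv[OF p] by simp
      also have "\<dots> \<le> boundary_measure M (closed_nbhd r A)"
        unfolding isoperimetric_profile_def using nbhd_sets by (intro INF_lower) (simp add: g_def)
      finally have p_le: "ereal p \<le> boundary_measure M (closed_nbhd r A)" .
      \<comment> \<open>The factor \<open>c < 1\<close> gives strict inequality if \<open>p > 0\<close>; otherwise positivity of the boundary measure does.\<close>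
      have "ereal (max 0 (c * p)) < boundary_measure M (closed_nbhd r A)"
      proof (cases "0 < p")
        case True
        then have "max 0 (c * p) < p" using c by (simp add: max_def)
        then have "ereal (max 0 (c * p)) < ereal p" by simp
        then show ?thesis using p_le by (rule less_le_trans)
      next
        case False
        then have "c * p \<le> 0" using c by (simp add: mult_le_0_iff)
        then have "max 0 (c * p) = 0" by simp
        then show ?thesis using bd_pos[OF rL] by (simp add: zero_ereal_def)
      qed
      then obtain m where m: "max 0 (c * p) < m" "ereal m < boundary_measure M (closed_nbhd r A)"
        using ereal_dense2 less_ereal.simps(1) by metis
      have "p < m / c" using m c by (simp add: pos_less_divide_eq mult.commute)
      moreover have "((\<lambda>h. (cdf \<nu> (T r + h) - cdf \<nu> (T r)) / h) \<longlongrightarrow> p) (at_right 0)"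
        using p unfolding DERIV_def by (rule tendsto_within_subset) simp
      ultimately have "\<forall>\<^sub>F h in at_right 0. (cdf \<nu> (T r + h) - cdf \<nu> (T r)) / h < m / c"
        by (metis order_tendstoD(2))
      then obtain e where e: "0 < e"
        "\<And>h. 0 < h \<Longrightarrow> h < e \<Longrightarrow> (cdf \<nu> (T r + h) - cdf \<nu> (T r)) / h < m / c"
        unfolding eventually_at_right_field by auto
      obtain d' where d': "0 < d'" "\<And>s. s \<in> {0..L} \<Longrightarrow> r < s \<Longrightarrow> s < r + d' \<Longrightarrow> T s < T r + e"
        using T_right_cont[OF rL e(1)] by auto
      have "0 < min d (min d' (L - r))" using d d' \<open>r < L\<close> by simp
      from boundary_measure_closed_nbhd_witness[OF M.finite_measure_axioms M(2) m(2) this]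
      obtain \<epsilon> where \<epsilon>: "0 < \<epsilon>" "\<epsilon> < min d (min d' (L - r))" "m * \<epsilon> < g (r + \<epsilon>) - g r"
        unfolding g_def by blast
      have in_dom: "r + \<epsilon> \<in> {0..L}" using \<epsilon> rL by auto
      \<comment> \<open>Now \<open>m \<epsilon> < V (T r + h) - V (T r) < (m / c) h\<close>, so the increment \<open>h\<close> of \<open>T\<close> exceeds \<open>c \<epsilon>\<close>.\<close>
      define h where "h = T (r + \<epsilon>) - T r"
      have "h < e" using d'(2)[OF in_dom] \<epsilon> by (simp add: h_def)
      have incr: "m * \<epsilon> < cdf \<nu> (T r + h) - cdf \<nu> (T r)"
        using \<epsilon>(3) T[OF rL] T[OF in_dom] by (simp add: h_def)
      have "0 < h"
      proof -
        have "0 \<le> h" using T_mono[OF rL in_dom] \<epsilon> by (simp add: h_def)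
        moreover have "h \<noteq> 0" using incr m \<epsilon>(1) by (auto simp: mult_less_0_iff)
        ultimately show ?thesis by simp
      qed
      then have "cdf \<nu> (T r + h) - cdf \<nu> (T r) < m / c * h"
        using e(2)[OF _ \<open>h < e\<close>] by (simp add: pos_divide_less_eq)
      with incr have "m * \<epsilon> < m * (h / c)" by simp
      then have "\<epsilon> < h / c" using m by (subst (asm) mult_less_cancel_left_pos) auto
      then have "c * \<epsilon> \<le> h" using c by (simp add: pos_less_divide_eq mult.commute)
      then have "ennreal (c * (r + \<epsilon> - r)) \<le> emeasure lborel {T r<..T (r + \<epsilon>)}"
        using \<open>0 < h\<close> by (simp add: h_def ennreal_leI)
      moreover have "{T r<..T (r + \<epsilon>)} \<subseteq> {T 0<..T L}"
        using T_mono[of 0 r] T_mono[of "r + \<epsilon>" L] rL in_dom ab_less by auto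
      ultimately show "\<exists>u\<in>{0..L}. \<exists>v\<in>{0..L}. u < v \<and> u \<le> r \<and> r \<le> v \<and> v - u < d \<and>
          {T u<..T v} \<subseteq> {T 0<..T L} \<and> ennreal (c * (v - u)) \<le> emeasure lborel {T u<..T v}"
        using rL in_dom \<epsilon> by (intro bexI[of _ r] bexI[of _ "r + \<epsilon>"]) auto
    qed auto
    have "negligible ({0..<L} - B)"
      using negligible_Un[OF B(2) R_negl] by (rule negligible_subset) auto
    then have rest: "{0..<L} - B \<in> null_sets lebesgue" by (simp add: negligible_iff_null_sets)
    have "ennreal L = emeasure lebesgue {0..<L}" using ab_less by simp
    also have "\<dots> \<le> emeasure lebesgue (B \<union> ({0..<L} - B))"
      using B(1) rest by (intro emeasure_mono) auto
    also have "\<dots> = emeasure lborel B"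
      using B(1) rest by (subst emeasure_Un_null_set) auto
    finally have "ennreal c * ennreal L \<le> ennreal c * emeasure lborel B" by (intro mult_left_mono) auto
    also have "\<dots> \<le> ennreal (T L - T 0)"
      using B(3) T_mono[of 0 L] ab_less by simp
    finally show "c * L \<le> T L - T 0"
      using c ab_less T_mono[of 0 L] by (simp add: ennreal_mult''[symmetric])
  qed
  then show False using T_range by (simp add: L_def)
qed

end

section \<open>Equivalence of the three conditions\<close>

theorem theorem3p4:
  fixes M :: "'a::polish_space measure" and \<nu> :: "real measure"
  assumes "mm_space M"
    and "geodesic_space TYPE('a)"
    and "essentially_connected M"
    and "\<nu> \<in> class_V"
  shows "(iso_dominant \<nu> M \<longleftrightarrow> ICL M \<nu>) \<and> (ICL M \<nu> \<longleftrightarrow> IC M \<nu>)"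
proof -
  interpret connected_ac_distribution \<nu>
    using assms(4)
    by (simp add: class_V_def connected_ac_distribution_def connected_ac_distribution_axioms_def
        real_distribution_def real_distribution_axioms_def)
  have M: "prob_space M" "sets M = sets borel" using assms(1) by (simp_all add: mm_space_def)
  show ?thesis
    using iso_dominant_imp_ICL[OF M] ICL_imp_iso_dominant[OF M] ICL_imp_IC[OF M]
      IC_imp_ICL[OF M assms(3)] by blast
qed

end
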